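(* Consider any feasible solution of the MAXBAND constraints on a network, and let $\zeta$ be any cycle in the chosen cycle basis $\mathcal B_\zeta$. For each artery segment $a\in A_\zeta^F\cup A_\zeta^B$ of $\zeta$, with consecutive signals $S_{ai}$, $i\in I_\zeta^a=\{1_\zeta^a,\dots,n_\zeta^a\}$ (increasing in the outbound direction), put $$\overline{t^a}=\sum_{i\in I_\zeta^a\setminus\{n_\zeta^a\}}\frac{d_i^a}{e_i^aT_1}-\sum_{i\in I_\zeta^a\setminus\{1_\zeta^a\}}\tau_{ai},\qquad \underline{t^a}=\sum_{i\in I_\zeta^a\setminus\{n_\zeta^a\}}\frac{d_i^a}{f_i^aT_2}-\sum_{i\in I_\zeta^a\setminus\{1_\zeta^a\}}\tau_{ai},$$ $$\overline{\phi^a}=-\tfrac12\left(r_{a,1_\zeta^a}+r_{a,n_\zeta^a}\right)+\overline{t^a}+1,\qquad \underline{\phi^a}=\tfrac12\left(r_{a,1_\zeta^a}+r_{a,n_\zeta^a}\right)+\underline{t^a}-1,$$ and for each $(b,j,i,c,k)\in J_\zeta$ put $$\overline{\Psi_{S_{bj},S_{ck}}^i}=\tfrac12(1+\overline\ell_{ck}+\overline\ell_{bj}),\qquad \underline{\Psi_{S_{bj},S_{ck}}^i}=\tfrac12(1-\overline\ell_{ck}-\overline\ell_{bj}).$$ Then the integer variable $C_\zeta$ in the network loop constraint of $\zeta$ satisfies $\underline{C_\zeta}\le C_\zeta\le\overline{C_\zeta}$, where $$\overline{C_\zeta}=\left\lfloor\sum_{a\in A_\zeta^F}\overline{\phi^a}-\sum_{a\in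 A_\zeta^B}\underline{\phi^a}+\sum_{(b,j,i,c,k)\in J_\zeta}\overline{\Psi_{S_{bj},S_{ck}}^i}\right\rfloor,$$ $$\underline{C_\zeta}=\left\lceil\sum_{a\in A_\zeta^F}\underline{\phi^a}-\sum_{a\in A_\zeta^B}\overline{\phi^a}+\sum_{(b,j,i,c,k)\in J_\zeta}\underline{\Psi_{S_{bj},S_{ck}}^i}\right\rceil.$$
   Context: $A$ is a finite set of two-way arteries meeting at junctions and forming a network; artery $a$ has signals $S_{a1},\dots,S_{an_a}$, numbered increasingly in the outbound direction. Barred parameters and variables refer to the inbound direction. Parameters (real numbers): $0<T_1\le T_2$ (bounds on the period length); for each signal, the red time $r_{ai}\in[0,1]$, inbound left turn phase time $\overline\ell_{ai}\ge0$, and advancement $\tau_{ai}$; for each $i=1,\dots,n_a-1$, the distance $d_i^a>0$ between $S_{ai}$ and $S_{a,i+1}$ and velocity bounds $0<e_i^a\le f_i^a$. Variables: $z$, $b_a$, $w_{ai}$, $t_i^a$ (nonnegative reals), $\overline\delta_{ai}\in\{0,1\}$, real internode offsets $\phi_{i,i+1}^a$, real intranode offsets $\Psi_{S_{bj},S_{ck}}^i$, and $C_\zeta\in\mathbb Z$ for every cycle $\zeta$ in a fixed cycle basis $\mathcal B_\zeta$ of the underlying undirected graph of the network. The MAXBAND constraints used here are: (1) $\frac1{T_2}\le z\le\frac1{T_1}$. (2) $w_{ai}+b_a\le1-r_{ai}$ for all $a\in A$, $i=1,\dots,n_a$. (3) $\frac{d_i^a}{f_i^a}z\le t_i^a\le\frac{d_i^a}{e_i^a}z$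 for all $a\in A$, $i=1,\dots,n_a-1$. (4) Definition of the internode offset: $\phi_{i,i+1}^a+\frac12r_{a,i+1}+w_{a,i+1}+\tau_{a,i+1}=\frac12r_{ai}+w_{ai}+t_i^a$ for all $a\in A$, $i=1,\dots,n_a-1$. (5) Intranode offset, where signals $S_{bj}$ of artery $b$ and $S_{ck}$ of artery $c$ meet at junction $i$: $\Psi_{S_{bj},S_{ck}}^i=\frac12-\frac12\left[(2\overline\delta_{ck}-1)\overline\ell_{ck}-(2\overline\delta_{bj}-1)\overline\ell_{bj}\right]$. (6) Network loop constraint: for each $\zeta\in\mathcal B_\zeta$, $$\sum_{a\in A_\zeta^F}\ \sum_{i\in I_\zeta^a\setminus\{n_\zeta^a\}}\phi_{i,i+1}^a-\sum_{a\in A_\zeta^B}\ \sum_{i\in I_\zeta^a\setminus\{n_\zeta^a\}}\phi_{i,i+1}^a+\sum_{(b,j,i,c,k)\in J_\zeta}\Psi_{S_{bj},S_{ck}}^i=C_\zeta.$$ Here the cycle $\zeta$ is traversed clockwise; it consists of artery segments, each a run of consecutive signals with index set $I_\zeta^a=\{1_\zeta^a,\dots,n_\zeta^a\}$ of consecutive integers with first element $1_\zeta^a$ and last element $n_\zeta^a$. $A_\zeta^F$ (resp. $A_\zeta^B$) is the set of segments traversed forward, i.e. in their outbound direction (resp. backward). $J_\zeta$ is the set of tuples $(b,j,i,c,k)$ such that at junction $i$ the cycle passes from artery $b$ at signal $S_{bj}$ to artery $c$ at signal $S_{ck}$. The full model has further constraints; a feasible solution satisfies in particular all those listed. *)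

theory Defs
  imports Complex_Main "Graph_Theory.Arc_Walk"
begin

section \<open>Networks\<close>

text \<open>
  The signals of artery \<open>a\<close> are the pairs \<open>(a, i)\<close> with \<open>1 \<le> i \<le> nsig N a\<close>, numbered in the
  outbound direction; \<open>junction N a i\<close> is the junction at which \<open>(a, i)\<close> stands. Two signals
  meet iff they stand at the same junction.
\<close>

record ('a, 'v) network =
  arteries :: "'a set"
  nsig :: "'a \<Rightarrow> nat"
  junction :: "'a \<Rightarrow> nat \<Rightarrow> 'v"

definition signals :: "('a, 'v) network \<Rightarrow> ('a \<times> nat) set" where
  "signals N = (SIGMA a : arteries N. {1..nsig N a})"

text \<open>The link \<open>(a, i)\<close> is the undirected edge between signals \<open>(a, i)\<close> and \<open>(a, i + 1)\<close>.\<close>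

definition links :: "('a, 'v) network \<Rightarrow> ('a \<times> nat) set" where
  "links N = (SIGMA a : arteries N. {1..<nsig N a})"

text \<open>
  The underlying undirected multigraph is represented by its bidirected version: each link
  \<open>(a, i)\<close> gives the outbound arc \<open>((a, i), True)\<close> and the inbound arc \<open>((a, i), False)\<close>.
\<close>

definition road_graph ::
  "('a, 'v) network \<Rightarrow> ('v, ('a \<times> nat) \<times> bool) pre_digraph" where
  "road_graph N =
    \<lparr> verts = (\<lambda>(a, i). junction N a i) ` signals N,
      arcs = links N \<times> UNIV,
      tail = (\<lambda>((a, i), out). if out then junction N a i else junction N a (i + 1)),
      head = (\<lambda>((a, i), out). if out then junction N a (i + 1) else junction N a i) \<rparr>"


section \<open>Cycles as sequences of artery segments\<close>

text \<open>
  A segment is a run of consecutive signals of an artery, with \<open>seg_first < seg_last\<close>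
  in the outbound numbering, together with the direction in which it is traversed.
\<close>

datatype 'a segment =
  Segment (seg_art: 'a) (seg_first: nat) (seg_last: nat) (seg_forward: bool)

definition seg_idx :: "'a segment \<Rightarrow> nat set" where
  "seg_idx s = {seg_first s..seg_last s}"

definition valid_segment :: "('a, 'v) network \<Rightarrow> 'a segment \<Rightarrow> bool" where
  "valid_segment N s \<longleftrightarrow> seg_art s \<in> arteries N \<and>
     1 \<le> seg_first s \<and> seg_first s < seg_last s \<and> seg_last s \<le> nsig N (seg_art s)"

definition seg_arcs :: "'a segment \<Rightarrow> (('a \<times> nat) \<times> bool) list" where
  "seg_arcs s =
    (if seg_forward s then map (\<lambda>i. ((seg_art s, i), True)) [seg_first s..<seg_last s]
     else map (\<lambda>i. ((seg_art s, i), False)) (rev [seg_first s..<seg_last s]))"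

definition seg_entry :: "'a segment \<Rightarrow> 'a \<times> nat" where
  "seg_entry s = (seg_art s, if seg_forward s then seg_first s else seg_last s)"

definition seg_exit :: "'a segment \<Rightarrow> 'a \<times> nat" where
  "seg_exit s = (seg_art s, if seg_forward s then seg_last s else seg_first s)"

definition cyc_arcs :: "'a segment list \<Rightarrow> (('a \<times> nat) \<times> bool) list" where
  "cyc_arcs \<zeta> = concat (map seg_arcs \<zeta>)"

definition cyc_links :: "'a segment list \<Rightarrow> ('a \<times> nat) set" where
  "cyc_links \<zeta> = fst ` set (cyc_arcs \<zeta>)"

definition next_seg :: "'a segment list \<Rightarrow> nat \<Rightarrow> 'a segment" where
  "next_seg \<zeta> m = \<zeta> ! ((m + 1) mod length \<zeta>)"

text \<open>
  A traversed cycle is the list of its segments in order of traversal. Distinctness of the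
  underlying links excludes running back and forth along one link, which is a cycle of the
  bidirected graph but not of the undirected one. The last condition makes the segments
  maximal: a new segment starts only where the cycle passes to another signal at the junction.
  The direction of traversal (clockwise, for a network drawn in the plane) is the one
  recorded by the list; nothing below depends on how it is chosen.
\<close>

definition network_cycle :: "('a, 'v) network \<Rightarrow> 'a segment list \<Rightarrow> bool" where
  "network_cycle N \<zeta> \<longleftrightarrow>
     (\<forall>s \<in> set \<zeta>. valid_segment N s) \<and>
     pre_digraph.cycle (road_graph N) (cyc_arcs \<zeta>) \<and>
     distinct (map fst (cyc_arcs \<zeta>)) \<and>
     (\<forall>m < length \<zeta>. seg_exit (\<zeta> ! m) \<noteq> seg_entry (next_seg \<zeta> m))"

definition forward_segs :: "'a segment list \<Rightarrow> 'a segment set" where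
  "forward_segs \<zeta> = {s \<in> set \<zeta>. seg_forward s}"

definition backward_segs :: "'a segment list \<Rightarrow> 'a segment set" where
  "backward_segs \<zeta> = {s \<in> set \<zeta>. \<not> seg_forward s}"

text \<open>The set \<open>J\<^sub>\<zeta>\<close> of tuples \<open>(b, j, i, c, k)\<close>.\<close>

definition passages ::
  "('a, 'v) network \<Rightarrow> 'a segment list \<Rightarrow> ('a \<times> nat \<times> 'v \<times> 'a \<times> nat) set" where
  "passages N \<zeta> = {(b, j, i, c, k). \<exists>m < length \<zeta>.
     (b, j) = seg_exit (\<zeta> ! m) \<and> (c, k) = seg_entry (next_seg \<zeta> m) \<and> i = junction N b j}"


section \<open>Cycle bases\<close>

text \<open>
  The cycle space over the two-element field consists of the link sets in which every junction
  has even degree (a loop counts twice), with symmetric difference as addition.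
\<close>

definition cycle_space :: "('a, 'v) network \<Rightarrow> ('a \<times> nat) set set" where
  "cycle_space N = {F. F \<subseteq> links N \<and>
     (\<forall>v. even (card {(a, i) \<in> F. junction N a i = v} +
                card {(a, i) \<in> F. junction N a (i + 1) = v}))}"

definition sym_diff_sum :: "'a segment list set \<Rightarrow> ('a \<times> nat) set" where
  "sym_diff_sum X = {e. odd (card {\<zeta> \<in> X. e \<in> cyc_links \<zeta>})}"

text \<open>A cycle basis carries one fixed traversal for each of its cycles.\<close>

definition cycle_basis :: "('a, 'v) network \<Rightarrow> 'a segment list set \<Rightarrow> bool" where
  "cycle_basis N B \<longleftrightarrow> finite B \<and> (\<forall>\<zeta> \<in> B. network_cycle N \<zeta>) \<and>
     (\<forall>F \<in> cycle_space N. \<exists>!X. X \<subseteq> B \<and> sym_diff_sum X = F)"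


section \<open>Parameters, variables and constraints\<close>

text \<open>
  \<open>lturn\<close> is the inbound left turn phase time, \<open>adv\<close> the advancement \<open>\<tau>\<close>, \<open>link_dist\<close> the
  distance \<open>d\<close>, and \<open>vlow\<close>, \<open>vhigh\<close> are the velocity bounds \<open>e\<close>, \<open>f\<close>.
\<close>

record 'a params =
  Tlow :: real
  Thigh :: real
  red :: "'a \<Rightarrow> nat \<Rightarrow> real"
  lturn :: "'a \<Rightarrow> nat \<Rightarrow> real"
  adv :: "'a \<Rightarrow> nat \<Rightarrow> real"
  link_dist :: "'a \<Rightarrow> nat \<Rightarrow> real"
  vlow :: "'a \<Rightarrow> nat \<Rightarrow> real"
  vhigh :: "'a \<Rightarrow> nat \<Rightarrow> real"

definition valid_params :: "('a, 'v) network \<Rightarrow> 'a params \<Rightarrow> bool" where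
  "valid_params N P \<longleftrightarrow>
     0 < Tlow P \<and> Tlow P \<le> Thigh P \<and>
     (\<forall>(a, i) \<in> signals N. 0 \<le> red P a i \<and> red P a i \<le> 1 \<and> 0 \<le> lturn P a i) \<and>
     (\<forall>(a, i) \<in> links N. 0 < link_dist P a i \<and> 0 < vlow P a i \<and> vlow P a i \<le> vhigh P a i)"

text \<open>
  \<open>phi x a i\<close> is the internode offset between signals \<open>(a, i)\<close> and \<open>(a, i + 1)\<close>;
  \<open>psi x (b, j, i, c, k)\<close> is the intranode offset between \<open>(b, j)\<close> and \<open>(c, k)\<close> at junction \<open>i\<close>.
\<close>

record ('a, 'v) vars =
  zv :: real
  band :: "'a \<Rightarrow> real"
  wv :: "'a \<Rightarrow> nat \<Rightarrow> real"
  tv :: "'a \<Rightarrow> nat \<Rightarrow> real"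
  delta :: "'a \<Rightarrow> nat \<Rightarrow> real"
  phi :: "'a \<Rightarrow> nat \<Rightarrow> real"
  psi :: "'a \<times> nat \<times> 'v \<times> 'a \<times> nat \<Rightarrow> real"
  loop_int :: "'a segment list \<Rightarrow> int"

definition var_domains :: "('a, 'v) network \<Rightarrow> ('a, 'v) vars \<Rightarrow> bool" where
  "var_domains N x \<longleftrightarrow>
     0 \<le> zv x \<and> (\<forall>a \<in> arteries N. 0 \<le> band x a) \<and>
     (\<forall>(a, i) \<in> signals N. 0 \<le> wv x a i \<and> delta x a i \<in> {0, 1}) \<and>
     (\<forall>(a, i) \<in> links N. 0 \<le> tv x a i)"

definition period_constraint :: "'a params \<Rightarrow> ('a, 'v) vars \<Rightarrow> bool" where
  "period_constraint P x \<longleftrightarrow> 1 / Thigh P \<le> zv x \<and> zv x \<le> 1 / Tlow P"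

definition band_constraint ::
  "('a, 'v) network \<Rightarrow> 'a params \<Rightarrow> ('a, 'v) vars \<Rightarrow> bool" where
  "band_constraint N P x \<longleftrightarrow> (\<forall>(a, i) \<in> signals N. wv x a i + band x a \<le> 1 - red P a i)"

definition travel_time_constraint ::
  "('a, 'v) network \<Rightarrow> 'a params \<Rightarrow> ('a, 'v) vars \<Rightarrow> bool" where
  "travel_time_constraint N P x \<longleftrightarrow> (\<forall>(a, i) \<in> links N.
     link_dist P a i / vhigh P a i * zv x \<le> tv x a i \<and>
     tv x a i \<le> link_dist P a i / vlow P a i * zv x)"

definition internode_constraint ::
  "('a, 'v) network \<Rightarrow> 'a params \<Rightarrow> ('a, 'v) vars \<Rightarrow> bool" where
  "internode_constraint N P x \<longleftrightarrow> (\<forall>(a, i) \<in> links N.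
     phi x a i + 1/2 * red P a (i + 1) + wv x a (i + 1) + adv P a (i + 1)
       = 1/2 * red P a i + wv x a i + tv x a i)"

definition intranode_constraint ::
  "('a, 'v) network \<Rightarrow> 'a params \<Rightarrow> ('a, 'v) vars \<Rightarrow> bool" where
  "intranode_constraint N P x \<longleftrightarrow> (\<forall>(b, j) \<in> signals N. \<forall>(c, k) \<in> signals N. \<forall>i.
     (b, j) \<noteq> (c, k) \<and> junction N b j = i \<and> junction N c k = i \<longrightarrow>
     psi x (b, j, i, c, k) =
       1/2 - 1/2 * ((2 * delta x c k - 1) * lturn P c k - (2 * delta x b j - 1) * lturn P b j))"

definition loop_constraint ::
  "('a, 'v) network \<Rightarrow> ('a, 'v) vars \<Rightarrow> 'a segment list \<Rightarrow> bool" where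
  "loop_constraint N x \<zeta> \<longleftrightarrow>
     (\<Sum>s \<in> forward_segs \<zeta>. \<Sum>i \<in> seg_idx s - {seg_last s}. phi x (seg_art s) i)
     - (\<Sum>s \<in> backward_segs \<zeta>. \<Sum>i \<in> seg_idx s - {seg_last s}. phi x (seg_art s) i)
     + (\<Sum>p \<in> passages N \<zeta>. psi x p)
     = of_int (loop_int x \<zeta>)"

definition maxband_feasible ::
  "('a, 'v) network \<Rightarrow> 'a params \<Rightarrow> 'a segment list set \<Rightarrow> ('a, 'v) vars \<Rightarrow> bool" where
  "maxband_feasible N P B x \<longleftrightarrow>
     var_domains N x \<and> period_constraint P x \<and> band_constraint N P x \<and>
     travel_time_constraint N P x \<and> internode_constraint N P x \<and>
     intranode_constraint N P x \<and> (\<forall>\<zeta> \<in> B. loop_constraint N x \<zeta>)"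


section \<open>The bounds\<close>

definition t_upper :: "'a params \<Rightarrow> 'a segment \<Rightarrow> real" where
  "t_upper P s =
     (\<Sum>i \<in> seg_idx s - {seg_last s}. link_dist P (seg_art s) i / (vlow P (seg_art s) i * Tlow P))
     - (\<Sum>i \<in> seg_idx s - {seg_first s}. adv P (seg_art s) i)"

definition t_lower :: "'a params \<Rightarrow> 'a segment \<Rightarrow> real" where
  "t_lower P s =
     (\<Sum>i \<in> seg_idx s - {seg_last s}. link_dist P (seg_art s) i / (vhigh P (seg_art s) i * Thigh P))
     - (\<Sum>i \<in> seg_idx s - {seg_first s}. adv P (seg_art s) i)"

definition phi_upper :: "'a params \<Rightarrow> 'a segment \<Rightarrow> real" where
  "phi_upper P s =
     - 1/2 * (red P (seg_art s) (seg_first s) + red P (seg_art s) (seg_last s)) + t_upper P s + 1"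

definition phi_lower :: "'a params \<Rightarrow> 'a segment \<Rightarrow> real" where
  "phi_lower P s =
     1/2 * (red P (seg_art s) (seg_first s) + red P (seg_art s) (seg_last s)) + t_lower P s - 1"

definition psi_upper :: "'a params \<Rightarrow> 'a \<times> nat \<times> 'v \<times> 'a \<times> nat \<Rightarrow> real" where
  "psi_upper P = (\<lambda>(b, j, i, c, k). 1/2 * (1 + lturn P c k + lturn P b j))"

definition psi_lower :: "'a params \<Rightarrow> 'a \<times> nat \<times> 'v \<times> 'a \<times> nat \<Rightarrow> real" where
  "psi_lower P = (\<lambda>(b, j, i, c, k). 1/2 * (1 - lturn P c k - lturn P b j))"

definition C_upper :: "('a, 'v) network \<Rightarrow> 'a params \<Rightarrow> 'a segment list \<Rightarrow> int" where
  "C_upper N P \<zeta> =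
     \<lfloor>(\<Sum>s \<in> forward_segs \<zeta>. phi_upper P s) - (\<Sum>s \<in> backward_segs \<zeta>. phi_lower P s)
       + (\<Sum>p \<in> passages N \<zeta>. psi_upper P p)\<rfloor>"

definition C_lower :: "('a, 'v) network \<Rightarrow> 'a params \<Rightarrow> 'a segment list \<Rightarrow> int" where
  "C_lower N P \<zeta> =
     \<lceil>(\<Sum>s \<in> forward_segs \<zeta>. phi_lower P s) - (\<Sum>s \<in> backward_segs \<zeta>. phi_upper P s)
       + (\<Sum>p \<in> passages N \<zeta>. psi_lower P p)\<rceil>"

end

(* Summing the internode offsets over a segment telescopes: what remains is
   (r_first - r_last)/2 + w_first - w_last plus travel times minus advancements. Since
   0 <= w_i <= 1 - r_i, this gives the bounds on the offset of the segment. *)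
theory Submission
  imports Defs
begin

section \<open>Internode offsets\<close>

lemma seg_idx_minus_last: "seg_idx s - {seg_last s} = {seg_first s..<seg_last s}"
  by (auto simp: seg_idx_def)

text \<open>The advancement in constraint (4) for link \<open>i\<close> is that of signal
  \<open>i + 1\<close>. This shift lets advancements be summed over the links of the segment,
  together with offsets and travel times.\<close>

lemma seg_idx_minus_first:
  assumes "valid_segment N s"
  shows "seg_idx s - {seg_first s} = Suc ` {seg_first s..<seg_last s}"
  using assms by (auto simp: seg_idx_def image_Suc_atLeastLessThan)

lemma sum_seg_idx_minus_first:
  assumes "valid_segment N s"
  shows "sum f (seg_idx s - {seg_first s}) = (\<Sum>i = seg_first s..<seg_last s. f (Suc i))"
  unfolding seg_idx_minus_first[OF assms] by (subst sum.reindex) (simp_all add: comp_def)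

lemma valid_segment_links:
  assumes "valid_segment N s" "i \<in> {seg_first s..<seg_last s}"
  shows "(seg_art s, i) \<in> links N"
  using assms by (auto simp: valid_segment_def links_def)

lemma segment_phi_sum:
  assumes "internode_constraint N P x" "valid_segment N s"
  defines "a \<equiv> seg_art s" and "k \<equiv> seg_first s" and "l \<equiv> seg_last s"
  shows "(\<Sum>i \<in> seg_idx s - {l}. phi x a i) =
    1/2 * (red P a k - red P a l) + (wv x a k - wv x a l)
    + (\<Sum>i = k..<l. tv x a i) - (\<Sum>i \<in> seg_idx s - {k}. adv P a i)"
proof -
  \<comment> \<open>\<open>g\<close> collects the terms of constraint (4) that occur once for each
    of the two neighbouring signals; its differences are what telescopes.\<close>
  define g where "g = (\<lambda>i. 1/2 * red P a i + wv x a i)"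
  have "phi x a i = tv x a i - adv P a (Suc i) - (g (Suc i) - g i)" if "i \<in> {k..<l}" for i
    using assms(1) valid_segment_links[OF assms(2)] that
    by (fastforce simp: internode_constraint_def g_def a_def k_def l_def)
  then have "(\<Sum>i = k..<l. phi x a i) =
    (\<Sum>i = k..<l. tv x a i - adv P a (Suc i) - (g (Suc i) - g i))"
    by (rule sum.cong[OF refl])
  also have "\<dots> = (\<Sum>i = k..<l. tv x a i) - (\<Sum>i = k..<l. adv P a (Suc i))
      - (\<Sum>i = k..<l. g (Suc i) - g i)"
    by (simp only: sum_subtractf)
  also have "(\<Sum>i = k..<l. g (Suc i) - g i) = g l - g k"
    using assms(2) by (intro sum_Suc_diff') (simp add: valid_segment_def k_def l_def)
  finally show ?thesis
    by (simp add: g_def a_def k_def l_def seg_idx_minus_last sum_seg_idx_minus_first[OF assms(2)]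
        right_diff_distrib)
qed

text \<open>Eliminates \<open>z\<close>: its coefficients in constraint (3) are positive, so the
  extreme values \<open>1 / Thigh\<close> and \<open>1 / Tlow\<close> from constraint (1) can be
  substituted for it.\<close>

lemma travel_time_bounds:
  assumes "valid_params N P" "period_constraint P x" "travel_time_constraint N P x"
    and link: "(a, i) \<in> links N"
  shows "link_dist P a i / (vhigh P a i * Thigh P) \<le> tv x a i"
    and "tv x a i \<le> link_dist P a i / (vlow P a i * Tlow P)"
proof -
  have pos: "0 < link_dist P a i" "0 < vlow P a i" "0 < vhigh P a i"
    using assms(1) link by (fastforce simp: valid_params_def)+
  have z: "1 / Thigh P \<le> zv x" "zv x \<le> 1 / Tlow P"
    using assms(2) by (auto simp: period_constraint_def)
  have t: "link_dist P a i / vhigh P a i * zv x \<le> tv x a i"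
    "tv x a i \<le> link_dist P a i / vlow P a i * zv x"
    using assms(3) link by (auto simp: travel_time_constraint_def)
  have "link_dist P a i / vhigh P a i * (1 / Thigh P) \<le> link_dist P a i / vhigh P a i * zv x"
    using pos z by (intro mult_left_mono) auto
  with t show "link_dist P a i / (vhigh P a i * Thigh P) \<le> tv x a i"
    by simp
  have "link_dist P a i / vlow P a i * zv x \<le> link_dist P a i / vlow P a i * (1 / Tlow P)"
    using pos z by (intro mult_left_mono) auto
  with t show "tv x a i \<le> link_dist P a i / (vlow P a i * Tlow P)"
    by simp
qed

lemma segment_phi_bounds:
  assumes "valid_params N P" "maxband_feasible N P B x" and s: "valid_segment N s"
  shows "phi_lower P s \<le> (\<Sum>i \<in> seg_idx s - {seg_last s}. phi x (seg_art s) i)"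
    and "(\<Sum>i \<in> seg_idx s - {seg_last s}. phi x (seg_art s) i) \<le> phi_upper P s"
proof -
  define a k l where "a = seg_art s" and "k = seg_first s" and "l = seg_last s"
  note feas = assms(2)[unfolded maxband_feasible_def]
  \<comment> \<open>Constraint (2) with the bandwidth dropped, as it is nonnegative.\<close>
  have w: "0 \<le> wv x a i" "wv x a i \<le> 1 - red P a i" if "(a, i) \<in> signals N" for i
  proof -
    have "0 \<le> wv x a i" "0 \<le> band x a" "wv x a i + band x a \<le> 1 - red P a i"
      using feas that by (auto simp: var_domains_def band_constraint_def signals_def)
    then show "0 \<le> wv x a i" "wv x a i \<le> 1 - red P a i" by auto
  qed
  have ends: "(a, k) \<in> signals N" "(a, l) \<in> signals N"
    using s by (auto simp: valid_segment_def signals_def a_def k_def l_def)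
  have link: "(a, i) \<in> links N" if "i \<in> {k..<l}" for i
    using valid_segment_links[OF s] that by (simp add: a_def k_def l_def)
  have t: "(\<Sum>i = k..<l. link_dist P a i / (vhigh P a i * Thigh P)) \<le> (\<Sum>i = k..<l. tv x a i)"
    "(\<Sum>i = k..<l. tv x a i) \<le> (\<Sum>i = k..<l. link_dist P a i / (vlow P a i * Tlow P))"
    using assms(1) feas link by (auto intro!: sum_mono travel_time_bounds)
  have phi: "(\<Sum>i \<in> seg_idx s - {l}. phi x a i) =
    1/2 * (red P a k - red P a l) + (wv x a k - wv x a l)
    + (\<Sum>i = k..<l. tv x a i) - (\<Sum>i \<in> seg_idx s - {k}. adv P a i)"
    unfolding a_def k_def l_def using feas s by (intro segment_phi_sum) auto
  have up: "phi_upper P s = - 1/2 * (red P a k + red P a l)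
      + ((\<Sum>i = k..<l. link_dist P a i / (vlow P a i * Tlow P))
         - (\<Sum>i \<in> seg_idx s - {k}. adv P a i)) + 1"
    and lo: "phi_lower P s = 1/2 * (red P a k + red P a l)
      + ((\<Sum>i = k..<l. link_dist P a i / (vhigh P a i * Thigh P))
         - (\<Sum>i \<in> seg_idx s - {k}. adv P a i)) - 1"
    by (simp_all only: phi_upper_def phi_lower_def t_upper_def t_lower_def seg_idx_minus_last
        a_def k_def l_def)
  \<comment> \<open>Linear arithmetic with the sums as atoms: \<open>w_k >= 0\<close> and
    \<open>w_l <= 1 - r_l\<close> turn \<open>(r_k - r_l)/2 + w_k - w_l\<close> into at least
    \<open>(r_k + r_l)/2 - 1\<close>.\<close>
  show "phi_lower P s \<le> (\<Sum>i \<in> seg_idx s - {seg_last s}. phi x (seg_art s) i)"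
    using phi lo t w[OF ends(1)] w[OF ends(2)] unfolding a_def[symmetric] l_def[symmetric]
    by argo
  \<comment> \<open>The roles of the end signals are exchanged: \<open>w_k <= 1 - r_k\<close> and
    \<open>w_l >= 0\<close> give at most \<open>1 - (r_k + r_l)/2\<close>.\<close>
  show "(\<Sum>i \<in> seg_idx s - {seg_last s}. phi x (seg_art s) i) \<le> phi_upper P s"
    using phi up t w[OF ends(1)] w[OF ends(2)] unfolding a_def[symmetric] l_def[symmetric]
    by argo
qed

section \<open>Intranode offsets\<close>

lemma (in pre_digraph) cas_ends:
  assumes "cas u p v" "p \<noteq> []"
  shows "tail G (hd p) = u" "head G (last p) = v"
  using assms by (induction u p v rule: cas.induct) (auto split: if_splits)

text \<open>A valid segment has at least one arc, so its first and last arcs determine the ends of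
  the walk, in either direction of traversal.\<close>

lemma cas_seg_arcs:
  assumes "valid_segment N s" "pre_digraph.cas (road_graph N) u (seg_arcs s) v"
  shows "case_prod (junction N) (seg_entry s) = u" "case_prod (junction N) (seg_exit s) = v"
proof -
  define k l where "k = seg_first s" and "l = seg_last s"
  have kl: "k < l" using assms(1) by (simp add: valid_segment_def k_def l_def)
  then have "seg_arcs s \<noteq> []" by (simp add: seg_arcs_def k_def l_def)
  note ends = pre_digraph.cas_ends[OF assms(2) this]
  \<comment> \<open>The outermost link at the far end is \<open>l - 1\<close>, joining signals
    \<open>l - 1\<close> and \<open>l\<close>; a backward traversal starts with it, at signal
    \<open>l\<close>.\<close>
  have "hd [k..<l] = k" "last [k..<l] = l - 1"
    using kl by (simp_all add: last_upt)
  then have "hd (seg_arcs s) = ((seg_art s, if seg_forward s then k else l - 1), seg_forward s)"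
    "last (seg_arcs s) = ((seg_art s, if seg_forward s then l - 1 else k), seg_forward s)"
    using kl by (auto simp: seg_arcs_def k_def[symmetric] l_def[symmetric]
        hd_map last_map hd_rev last_rev)
  with ends kl show "case_prod (junction N) (seg_entry s) = u"
    "case_prod (junction N) (seg_exit s) = v"
    by (auto simp: road_graph_def seg_entry_def seg_exit_def k_def[symmetric] l_def[symmetric])
qed

text \<open>Cuts a walk at its segment boundaries. The ends \<open>u\<close> and \<open>v\<close>
  are kept separate because the tail of a closed walk, to which the induction hypothesis applies,
  need not be closed.\<close>

lemma cas_cyc_arcs:
  assumes "\<forall>s \<in> set \<zeta>. valid_segment N s" "pre_digraph.cas (road_graph N) u (cyc_arcs \<zeta>) v"
  shows "(\<zeta> \<noteq> [] \<longrightarrow> case_prod (junction N) (seg_entry (\<zeta> ! 0)) = u) \<and>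
    (\<forall>m < length \<zeta>. case_prod (junction N) (seg_exit (\<zeta> ! m)) =
      (if Suc m = length \<zeta> then v else case_prod (junction N) (seg_entry (\<zeta> ! Suc m))))"
  using assms
proof (induction \<zeta> arbitrary: u)
  case (Cons s \<zeta>)
  obtain w where s: "pre_digraph.cas (road_graph N) u (seg_arcs s) w"
    and rest: "pre_digraph.cas (road_graph N) w (cyc_arcs \<zeta>) v"
    using Cons.prems(2) by (auto simp: cyc_arcs_def pre_digraph.cas_append_iff)
  have ends: "case_prod (junction N) (seg_entry s) = u" "case_prod (junction N) (seg_exit s) = w"
    using cas_seg_arcs[OF _ s] Cons.prems(1) by auto
  have IH: "\<zeta> \<noteq> [] \<longrightarrow> case_prod (junction N) (seg_entry (\<zeta> ! 0)) = w"
    "\<forall>m < length \<zeta>. case_prod (junction N) (seg_exit (\<zeta> ! m)) =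
      (if Suc m = length \<zeta> then v else case_prod (junction N) (seg_entry (\<zeta> ! Suc m)))"
    using Cons.IH[OF _ rest] Cons.prems(1) by simp_all
  \<comment> \<open>Covers the case where \<open>s\<close> is the last segment: the remaining walk
    is empty, so \<open>s\<close> already ends at \<open>v\<close>.\<close>
  have "w = v" if "\<zeta> = []"
    using rest that by (simp add: cyc_arcs_def pre_digraph.cas.simps)
  then show ?case
    using ends IH by (simp add: All_less_Suc2)
qed simp

text \<open>A cycle is a walk with \<open>u = v\<close>, so the last exit meets the first entry;
  this is the wrap-around in \<open>next_seg\<close>.\<close>

lemma network_cycle_junctions:
  assumes "network_cycle N \<zeta>" "m < length \<zeta>"
  shows "case_prod (junction N) (seg_exit (\<zeta> ! m)) =
    case_prod (junction N) (seg_entry (next_seg \<zeta> m))"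
proof -
  have val: "\<forall>s \<in> set \<zeta>. valid_segment N s"
    and cyc: "pre_digraph.cycle (road_graph N) (cyc_arcs \<zeta>)"
    using assms(1) by (auto simp: network_cycle_def)
  from cyc obtain u where cas: "pre_digraph.cas (road_graph N) u (cyc_arcs \<zeta>) u"
    by (auto simp: pre_digraph.cycle_def pre_digraph.awalk_def)
  show ?thesis
    using cas_cyc_arcs[OF val cas] assms(2)
    by (cases "Suc m = length \<zeta>"; cases "\<zeta> = []") (auto simp: next_seg_def)
qed

lemma valid_segment_signals:
  assumes "valid_segment N s"
  shows "seg_entry s \<in> signals N" "seg_exit s \<in> signals N"
  using assms by (auto simp: valid_segment_def seg_entry_def seg_exit_def signals_def)

text \<open>Provides exactly the premises under which \<open>intranode_constraint\<close> determines
  \<open>psi\<close>.\<close>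

lemma passages_meet:
  assumes "network_cycle N \<zeta>" "(b, j, i, c, k) \<in> passages N \<zeta>"
  shows "(b, j) \<in> signals N" "(c, k) \<in> signals N" "(b, j) \<noteq> (c, k)"
    "junction N b j = i" "junction N c k = i"
proof -
  obtain m where m: "m < length \<zeta>" "(b, j) = seg_exit (\<zeta> ! m)"
    "(c, k) = seg_entry (next_seg \<zeta> m)" "i = junction N b j"
    using assms(2) by (auto simp: passages_def)
  have "\<zeta> ! m \<in> set \<zeta>" "next_seg \<zeta> m \<in> set \<zeta>"
    using m(1) by (auto simp: next_seg_def intro!: nth_mem mod_less_divisor)
  then show "(b, j) \<in> signals N" "(c, k) \<in> signals N"
    using assms(1) m valid_segment_signals by (metis network_cycle_def)+
  \<comment> \<open>This is the maximality of segments demanded by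
    \<open>network_cycle\<close>.\<close>
  show "(b, j) \<noteq> (c, k)"
    using assms(1) m by (simp add: network_cycle_def)
  show "junction N b j = i" using m by simp
  show "junction N c k = i"
    using network_cycle_junctions[OF assms(1) m(1)] m(2-4) by (metis case_prod_conv)
qed

text \<open>Since \<open>delta\<close> is 0 or 1, each factor \<open>2 * delta - 1\<close> is a
  sign, and the bracket in constraint (5) is at most the sum of the two left turn times in absolute
  value.\<close>

lemma psi_bounds:
  assumes "valid_params N P" "maxband_feasible N P B x" "network_cycle N \<zeta>"
    and "p \<in> passages N \<zeta>"
  shows "psi_lower P p \<le> psi x p" "psi x p \<le> psi_upper P p"
proof -
  obtain b j i c k where p: "p = (b, j, i, c, k)" by (cases p) auto
  note meet = passages_meet[OF assms(3) assms(4)[unfolded p]]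
  have "psi x p =
      1/2 - 1/2 * ((2 * delta x c k - 1) * lturn P c k - (2 * delta x b j - 1) * lturn P b j)"
    using assms(2) meet unfolding p maxband_feasible_def intranode_constraint_def by blast
  moreover have "delta x b j \<in> {0, 1}" "delta x c k \<in> {0, 1}"
    using assms(2) meet by (auto simp: maxband_feasible_def var_domains_def)
  moreover have "0 \<le> lturn P b j" "0 \<le> lturn P c k"
    using assms(1) meet by (auto simp: valid_params_def)
  ultimately show "psi_lower P p \<le> psi x p" "psi x p \<le> psi_upper P p"
    by (auto simp: p psi_lower_def psi_upper_def field_simps)
qed

section \<open>The loop integer\<close>

theorem mainTheorem3:
  fixes N :: "('a, 'v) network" and P :: "'a params" and x :: "('a, 'v) vars"
    and B :: "'a segment list set" and \<zeta> :: "'a segment list"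
  assumes "finite (arteries N)"
    and "valid_params N P"
    and "cycle_basis N B"
    and "maxband_feasible N P B x"
    and "\<zeta> \<in> B"
  shows "C_lower N P \<zeta> \<le> loop_int x \<zeta> \<and> loop_int x \<zeta> \<le> C_upper N P \<zeta>"
proof -
  have cyc: "network_cycle N \<zeta>" and loop: "loop_constraint N x \<zeta>"
    using assms by (auto simp: cycle_basis_def maxband_feasible_def)
  define \<Phi> where "\<Phi> s = (\<Sum>i \<in> seg_idx s - {seg_last s}. phi x (seg_art s) i)" for s
  have val: "valid_segment N s" if "s \<in> forward_segs \<zeta> \<union> backward_segs \<zeta>" for s
    using cyc that by (auto simp: network_cycle_def forward_segs_def backward_segs_def)
  \<comment> \<open>Both bounds are needed for both directions: backward segments enter the loop
    constraint with a minus sign, which exchanges upper and lower.\<close>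
  have seg: "sum (phi_lower P) S \<le> sum \<Phi> S" "sum \<Phi> S \<le> sum (phi_upper P) S"
    if "S \<subseteq> forward_segs \<zeta> \<union> backward_segs \<zeta>" for S
    unfolding \<Phi>_def using that segment_phi_bounds[OF assms(2,4) val]
    by (blast intro: sum_mono)+
  have pas: "sum (psi_lower P) (passages N \<zeta>) \<le> sum (psi x) (passages N \<zeta>)"
    "sum (psi x) (passages N \<zeta>) \<le> sum (psi_upper P) (passages N \<zeta>)"
    using psi_bounds[OF assms(2,4) cyc] by (blast intro: sum_mono)+
  have "of_int (loop_int x \<zeta>) =
      sum \<Phi> (forward_segs \<zeta>) - sum \<Phi> (backward_segs \<zeta>) + sum (psi x) (passages N \<zeta>)"
    using loop by (simp add: loop_constraint_def \<Phi>_def)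
  \<comment> \<open>Because the loop variable is an integer, the real bounds on it may be rounded
    inward.\<close>
  with seg[of "forward_segs \<zeta>"] seg[of "backward_segs \<zeta>"] pas show ?thesis
    unfolding C_lower_def C_upper_def ceiling_le_iff le_floor_iff by simp
qed

end
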